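(* Let $n\geq 3$ be an odd integer. The discrete sine transform matrix $S_n$ of modulus $n$ has the nonvanishing minors property if and only if $n$ is prime.
   Context: A square matrix has the nonvanishing minors property if the determinant of every square submatrix (obtained by choosing any set of $k$ rows and any set of $k$ columns, $k\ge 1$, including the whole matrix and the $1\times1$ submatrices) is nonzero. For odd $n\ge 3$, the discrete sine transform matrix $S_n$ of modulus $n$ is the $\frac{n-1}{2}\times\frac{n-1}{2}$ matrix with rows and columns indexed from $1$ to $(n-1)/2$ whose entry in row $r$ and column $s$ is $(S_n)_{r,s}=\dfrac{2\sin(2\pi rs/n)}{\sqrt n}$. *)

theory Defs
  imports Complex_Main
    "HOL-Computational_Algebra.Primes"
    "Jordan_Normal_Form.Determinant"
    "Jordan_Normal_Form.DL_Submatrix"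
begin

text \<open>
  Row and column sets are subsets of the 0-based index range. The range restriction makes
  the selected submatrix have exactly \<open>card I\<close> rows and \<open>card J\<close> columns.
\<close>

definition nonvanishing_minors :: "'a :: comm_ring_1 mat \<Rightarrow> bool" where
  "nonvanishing_minors A \<longleftrightarrow> square_mat A \<and>
     (\<forall>I J. I \<subseteq> {0..<dim_row A} \<longrightarrow> J \<subseteq> {0..<dim_col A} \<longrightarrow>
        card I = card J \<longrightarrow> card I \<ge> 1 \<longrightarrow> det (submatrix A I J) \<noteq> 0)"

text \<open>
  Matrix indices start at 0 in the library, so row \<open>r\<close> and column \<open>s\<close> of the usual
  1-based description are addressed as \<open>r - 1\<close> and \<open>s - 1\<close>.
\<close>

definition dst_mat :: "nat \<Rightarrow> real mat" where
  "dst_mat n = mat ((n - 1) div 2) ((n - 1) div 2)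
     (\<lambda>(i, j). 2 * sin (2 * pi * real (i + 1) * real (j + 1) / real n) / sqrt (real n))"

end

theory Submission
  imports Defs
    "Jordan_Normal_Form.Char_Poly"
    "HOL-Number_Theory.Cong"
begin

text \<open>
  For \<open>n = a b\<close> composite the entry in row \<open>a\<close> and column \<open>b\<close> vanishes. For \<open>n = p\<close> prime, write
  \<open>sin (s t) = sin t * V\<^sub>s (2 cos t - 2)\<close> with integer polynomials \<open>V\<^sub>s\<close> (\<open>sin_poly\<close>) whose \<open>l\<close>-th coefficient is
  \<open>s + l choose 2 l + 1\<close>. A minor is then, up to nonzero factors, \<open>det (V\<^sub>s\<^sub>j (w\<^sub>i))\<close> with distinct
  \<open>w\<^sub>i = x ^ r\<^sub>i + x ^ (p - r\<^sub>i) - 2\<close> and \<open>x\<close> a primitive \<open>p\<close>-th root of unity. Newton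
  interpolation splits off the Vandermonde determinant of the \<open>w\<^sub>i\<close>, leaving an integer polynomial \<open>E\<close>
  evaluated at \<open>x\<close>. If \<open>E x = 0\<close> then \<open>p\<close> divides \<open>E 1\<close>. But at \<open>x = 1\<close> all nodes collapse to 0, so
  \<open>E 1\<close> is the determinant of the binomial coefficients \<open>s\<^sub>j + l choose 2 l + 1\<close>, and it divides
  \<open>\<Prod>s\<^sub>j * \<Prod>(s\<^sub>i\<^sup>2 - s\<^sub>m\<^sup>2)\<close>, which is prime to \<open>p\<close> because \<open>0 < s\<^sub>j < p / 2\<close>.
\<close>

section \<open>Newton interpolation and alternant determinants\<close>

text \<open>Repeated division by \<open>X - w l\<close>; the resulting
  \<open>newton_coeff w f l\<close> are the divided differences of \<open>f\<close> at
  \<open>w 0, ..., w l\<close>. Synthetic division avoids denominators, so they make sense over any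
  commutative ring and for coinciding nodes.\<close>

primrec newton_quot :: "(nat \<Rightarrow> 'a :: comm_ring_1) \<Rightarrow> 'a poly \<Rightarrow> nat \<Rightarrow> 'a poly" where
  "newton_quot w f 0 = f"
| "newton_quot w f (Suc l) = synthetic_div (newton_quot w f l) (w l)"

definition newton_coeff :: "(nat \<Rightarrow> 'a :: comm_ring_1) \<Rightarrow> 'a poly \<Rightarrow> nat \<Rightarrow> 'a" where
  "newton_coeff w f l = poly (newton_quot w f l) (w l)"

lemma newton_expansion:
  "poly f z = (\<Sum>l<k. (\<Prod>m<l. z - w m) * newton_coeff w f l)
     + (\<Prod>m<k. z - w m) * poly (newton_quot w f k) z"
proof (induction k)
  case (Suc k)
  have "poly (newton_quot w f k) z
      = (z - w k) * poly (newton_quot w f (Suc k)) z + newton_coeff w f k"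
    unfolding newton_coeff_def newton_quot.simps
    by (subst synthetic_div_correct'[of "w k", symmetric]) (simp add: algebra_simps)
  with Suc show ?case by (simp add: algebra_simps)
qed simp

text \<open>At a node \<open>w i\<close> with \<open>i < k\<close> the remainder of the Newton
  expansion vanishes, so the matrix factors as \<open>L * N\<close> with \<open>L\<close> lower
  triangular; the diagonal of \<open>L\<close> gives the Vandermonde product.\<close>

lemma det_alternant:
  fixes w :: "nat \<Rightarrow> 'a :: idom"
  shows "det (mat k k (\<lambda>(i, j). poly (f j) (w i)))
    = (\<Prod>i<k. \<Prod>m<i. w i - w m) * det (mat k k (\<lambda>(l, j). newton_coeff w (f j) l))"
proof -
  define L where "L = mat k k (\<lambda>(i, l). \<Prod>m<l. w i - w m)"
  define N where "N = mat k k (\<lambda>(l, j). newton_coeff w (f j) l)"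
  have "mat k k (\<lambda>(i, j). poly (f j) (w i)) = L * N"
  proof (rule eq_matI)
    fix i j assume "i < dim_row (L * N)" "j < dim_col (L * N)"
    then have ij: "i < k" "j < k" by (simp_all add: L_def N_def)
    then have "(\<Prod>m<k. w i - w m) = 0" by auto
    then have "poly (f j) (w i) = (\<Sum>l<k. (\<Prod>m<l. w i - w m) * newton_coeff w (f j) l)"
      using newton_expansion[of "f j" "w i" w k] by simp
    with ij show "mat k k (\<lambda>(i, j). poly (f j) (w i)) $$ (i, j) = (L * N) $$ (i, j)"
      by (simp add: L_def N_def scalar_prod_def atLeast0LessThan)
  qed (simp_all add: L_def N_def)
  moreover have "det L = (\<Prod>i<k. \<Prod>m<i. w i - w m)"
    by (subst det_lower_triangular[of k])
      (auto simp: L_def prod_list_diag_prod atLeast0LessThan)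
  moreover have "det (L * N) = det L * det N"
    by (rule det_mult[of _ k]) (simp_all add: L_def N_def)
  ultimately show ?thesis by (simp add: N_def)
qed

lemma (in comm_ring_hom) newton_quot_hom:
  "newton_quot (\<lambda>i. hom (w i)) (map_poly hom f) l = map_poly hom (newton_quot w f l)"
proof (induction l)
  case (Suc l)
  have "synthetic_div (map_poly hom g) (hom c) = map_poly hom (synthetic_div g c)" for g c
    by (induction g) (simp_all add: hom_distribs)
  with Suc show ?case by simp
qed simp

text \<open>Allows one determinant over integer polynomials to be specialised both at a root of
  unity and at 1, where the nodes merge.\<close>

lemma (in comm_ring_hom) newton_coeff_hom:
  "newton_coeff (\<lambda>i. hom (w i)) (map_poly hom f) l = hom (newton_coeff w f l)"
  by (simp add: newton_coeff_def newton_quot_hom)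

text \<open>Synthetic division at 0 merely shifts the coefficients.\<close>

lemma newton_coeff_zero_points: "newton_coeff (\<lambda>_. 0) f l = coeff f l"
proof -
  have "coeff (synthetic_div g 0) n = coeff g (Suc n)" for g :: "'a poly" and n
    using arg_cong[OF synthetic_div_correct'[of 0 g], of "\<lambda>q. coeff q (Suc n)"] by simp
  then have "coeff (newton_quot (\<lambda>_. 0) f l) n = coeff f (l + n)" for n
    by (induction l arbitrary: n) simp_all
  then show ?thesis by (simp add: newton_coeff_def poly_0_coeff_0)
qed

lemma degree_newton_quot: "degree (newton_quot w f l) = degree f - l"
  by (induction l) (simp_all add: degree_synthetic_div)

lemma coeff_synthetic_div_degree:
  assumes "degree f > 0"
  shows "coeff (synthetic_div f c) (degree f - 1) = lead_coeff f"
proof -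
  have "degree (synthetic_div f c) < degree f"
    using assms by (simp add: degree_synthetic_div)
  then show ?thesis
    using arg_cong[OF synthetic_div_correct[of f c], of "\<lambda>q. coeff q (degree f)"] assms
    by (auto simp: coeff_eq_0 coeff_pCons gr0_conv_Suc)
qed

lemma coeff_newton_quot_degree:
  "l \<le> degree f \<Longrightarrow> coeff (newton_quot w f l) (degree f - l) = lead_coeff f"
proof (induction l)
  case (Suc l)
  then show ?case
    using coeff_synthetic_div_degree[of "newton_quot w f l" "w l"]
    by (simp add: degree_newton_quot)
qed simp

lemma newton_coeff_degree: "newton_coeff w f (degree f) = lead_coeff f"
  using degree_newton_quot[of w f "degree f"] coeff_newton_quot_degree[of "degree f" f w]
  by (auto simp: newton_coeff_def elim: degree_eq_zeroE)

lemma newton_coeff_above_degree: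
  assumes "degree f < l"
  shows "newton_coeff w f l = 0"
proof -
  obtain d where l: "l = Suc (degree f + d)" using assms less_iff_Suc_add by auto
  have "degree (newton_quot w f (degree f + d)) = 0" by (simp add: degree_newton_quot)
  then show ?thesis by (simp add: l newton_coeff_def synthetic_div_eq_0_iff[THEN iffD2])
qed

text \<open>The matrix of Newton coefficients is upper triangular with unit diagonal, so only the
  Vandermonde product remains.\<close>

lemma det_monic_alternant:
  fixes w :: "nat \<Rightarrow> 'a :: idom"
  assumes "\<And>j. j < k \<Longrightarrow> degree (f j) = j" and "\<And>j. j < k \<Longrightarrow> lead_coeff (f j) = 1"
  shows "det (mat k k (\<lambda>(i, j). poly (f j) (w i))) = (\<Prod>i<k. \<Prod>m<i. w i - w m)"
proof -
  let ?N = "mat k k (\<lambda>(l, j). newton_coeff w (f j) l)"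
  have "newton_coeff w (f j) j = 1" if "j < k" for j
    using newton_coeff_degree[of w "f j"] assms[OF that] by simp
  moreover have "upper_triangular ?N"
    using assms(1) by (auto simp: newton_coeff_above_degree)
  ultimately have "det ?N = 1"
    by (subst det_upper_triangular[of _ k]) (auto simp: prod_list_diag_prod)
  then show ?thesis by (simp add: det_alternant)
qed

text \<open>Each Leibniz term contains every row factor and every column factor exactly
  once.\<close>

lemma det_scale_rows_cols:
  fixes A :: "nat \<Rightarrow> nat \<Rightarrow> 'a :: comm_ring_1"
  shows "det (mat k k (\<lambda>(i, j). c i * d j * A i j))
    = (\<Prod>i<k. c i) * (\<Prod>j<k. d j) * det (mat k k (\<lambda>(i, j). A i j))"
proof -
  have "(\<Prod>i = 0..<k. mat k k (\<lambda>(i, j). c i * d j * A i j) $$ (i, q i))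
      = (\<Prod>i<k. c i) * (\<Prod>j<k. d j) * (\<Prod>i = 0..<k. mat k k (\<lambda>(i, j). A i j) $$ (i, q i))"
    if q: "q permutes {0..<k}" for q
  proof -
    have "q i < k" if "i < k" for i using permutes_in_image[OF q, of i] that by simp
    moreover have "(\<Prod>i = 0..<k. d (q i)) = (\<Prod>j<k. d j)"
      using prod.permute[OF q, of d] by (simp add: atLeast0LessThan o_def)
    ultimately show ?thesis by (simp add: prod.distrib atLeast0LessThan)
  qed
  then show ?thesis
    by (simp add: det_def'[of _ k] sum_distrib_left mult.assoc mult.left_commute)
qed

section \<open>Sine multiples and their binomial coefficients\<close>

text \<open>For \<open>n > 0\<close> this is the Chebyshev polynomial of the second kind of degree
  \<open>n - 1\<close>, taken at \<open>X / 2 + 1\<close>. The variable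
  \<open>X = 2 cos t - 2\<close> is chosen so that \<open>t = 0\<close> becomes
  \<open>X = 0\<close>.\<close>

fun sin_poly :: "nat \<Rightarrow> int poly" where
  "sin_poly 0 = 0"
| "sin_poly (Suc 0) = 1"
| "sin_poly (Suc (Suc n)) = [:2, 1:] * sin_poly (Suc n) - sin_poly n"

lemma coeff_sin_poly: "coeff (sin_poly n) l = int ((n + l) choose (2 * l + 1))"
proof (induction n arbitrary: l rule: sin_poly.induct)
  case 2
  show ?case by (cases l) (simp_all add: binomial_eq_0)
next
  case (3 n)
  show ?case
  proof (cases l)
    case 0
    then show ?thesis using 3[of 0] by simp
  next
    case (Suc m)
    \<comment> \<open>A second difference in the upper index, matching the recursion of
      \<open>sin_poly\<close>.\<close>
    have pascal: "(a + 2 choose (b + 2)) + (a choose (b + 2)) = 2 * (a + 1 choose (b + 2)) + (a choose b)" for a b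
      by simp
    from pascal[of "n + Suc m" "2 * m + 1"] show ?thesis
      using 3(1)[of l] 3(2)[of l] 3(1)[of m] by (simp add: Suc coeff_pCons numeral_eq_Suc)
  qed
qed simp

lemma sin_multiple:
  "sin (real n * t) = sin t * poly (of_int_poly (sin_poly n)) (2 * cos t - 2)"
proof (induction n rule: sin_poly.induct)
  case (3 n)
  have "sin (real (Suc (Suc n)) * t) = 2 * cos t * sin (real (Suc n) * t) - sin (real n * t)"
    using sin_add[of "real (Suc n) * t" t] sin_diff[of "real (Suc n) * t" t]
    by (simp add: algebra_simps)
  then show ?case unfolding 3 by (simp add: hom_distribs algebra_simps)
qed simp_all

text \<open>The left side is the product of the integers from \<open>s - l\<close> to
  \<open>s + l\<close>, paired symmetrically about \<open>s\<close>. This exhibits it as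
  \<open>s\<close> times a monic polynomial of degree \<open>l\<close> in the square of
  \<open>s\<close>.\<close>

lemma fact_times_central_binomial:
  "int (fact (2 * l + 1)) * int ((s + l) choose (2 * l + 1))
    = int s * (\<Prod>m<l. (int s)\<^sup>2 - (int (Suc m))\<^sup>2)"
proof (induction l)
  case (Suc l)
  \<comment> \<open>Passing from \<open>l\<close> to \<open>l + 1\<close> adds two outer factors:
    \<open>s + l + 1\<close> here and \<open>s - l - 1\<close> in the next fact.\<close>
  have 1: "int (2 * l + 3) * int (s + Suc l choose (2 * l + 3))
      = int (s + l + 1) * int (s + l choose (2 * l + 2))"
    using Suc_times_binomial_eq[of "s + l" "2 * l + 2"]
    unfolding of_nat_mult[symmetric] of_nat_eq_iff by (simp add: numeral_eq_Suc mult.commute)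
  have 2: "int (2 * l + 2) * int (s + l choose (2 * l + 2))
      = (int s - int l - 1) * int (s + l choose (2 * l + 1))"
  \<comment> \<open>For \<open>s \<le> l\<close> natural subtraction would truncate, but then both
    binomials vanish.\<close>
  proof (cases "s > l")
    case True
    have "int (2 * l + 2) * int (s + l choose (2 * l + 2)) = int (s + l - (2 * l + 1)) * int (s + l choose (2 * l + 1))"
      using binomial_absorb_comp[of "s + l" "2 * l + 1"] binomial_absorption[of "2 * l + 1" "s + l"]
      unfolding of_nat_mult[symmetric] of_nat_eq_iff by simp
    with True show ?thesis by (simp add: of_nat_diff)
  qed (simp add: binomial_eq_0)
  have "int (fact (2 * Suc l + 1)) * int ((s + Suc l) choose (2 * Suc l + 1))
     = int (fact (2 * l + 1)) * (int (2 * l + 2) * (int (2 * l + 3) * int (s + Suc l choose (2 * l + 3))))"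
    by (simp add: numeral_eq_Suc algebra_simps)
  also have "\<dots> = (int (fact (2 * l + 1)) * int (s + l choose (2 * l + 1))) * ((int s)\<^sup>2 - (int (Suc l))\<^sup>2)"
    unfolding 1 mult.left_commute[of "int (2 * l + 2)"] 2
    by (simp add: algebra_simps power2_eq_square)
  finally show ?case unfolding Suc by simp
qed simp

section \<open>Frobenius and divisibility by a prime in cyclotomic integers\<close>

lemma power_prime_add:
  fixes a b :: "'a :: comm_ring_1"
  assumes "prime p"
  shows "\<exists>c. (a + b) ^ p = a ^ p + b ^ p + of_nat p * c"
proof -
  have "(a + b) ^ p = (\<Sum>k\<le>p. of_nat (p choose k) * a ^ k * b ^ (p - k))"
    by (rule binomial_ring)
  also have "{..p} = {0, p} \<union> {1..<p}" using prime_gt_0_nat[OF assms] by auto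
  also have "(\<Sum>k\<in>\<dots>. of_nat (p choose k) * a ^ k * b ^ (p - k))
      = a ^ p + b ^ p + (\<Sum>k\<in>{1..<p}. of_nat (p choose k) * a ^ k * b ^ (p - k))"
    using prime_gt_0_nat[OF assms] by (subst sum.union_disjoint) auto
  also have "(\<Sum>k\<in>{1..<p}. of_nat (p choose k) * a ^ k * b ^ (p - k))
      = of_nat p * (\<Sum>k\<in>{1..<p}. of_nat ((p choose k) div p) * a ^ k * b ^ (p - k))"
    unfolding sum_distrib_left
  proof (rule sum.cong)
    fix k assume "k \<in> {1..<p}"
    then have "p dvd (p choose k)" using assms by (intro dvd_choose_prime) auto
    then have "p choose k = p * ((p choose k) div p)" by simp
    then have "(of_nat (p choose k) :: 'a) = of_nat p * of_nat ((p choose k) div p)"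
      by (metis of_nat_mult)
    then show "of_nat (p choose k) * a ^ k * b ^ (p - k)
        = of_nat p * (of_nat ((p choose k) div p) * a ^ k * b ^ (p - k))"
      by (simp add: mult.assoc)
  qed simp
  finally show ?thesis by blast
qed

lemma fermat_int:
  fixes a :: int
  assumes "prime p"
  shows "\<exists>b. a ^ p = a + int p * b"
proof -
  have pos: "p > 0" using assms prime_gt_0_nat by blast
  have nat: "\<exists>b. int m ^ p = int m + int p * b" for m
  proof (induction m)
    case 0
    show ?case using pos by (intro exI[of _ 0]) simp
  next
    case (Suc m)
    then obtain b where "int m ^ p = int m + int p * b" by blast
    moreover obtain c where "(int m + 1) ^ p = int m ^ p + 1 ^ p + int p * c"
      using power_prime_add[OF assms, of "int m" 1] by auto
    ultimately show ?case by (intro exI[of _ "b + c"]) (simp add: algebra_simps)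
  qed
  show ?thesis
  proof (cases a rule: int_cases2)
    case (nonneg m)
    then show ?thesis using nat by simp
  next
    case (nonpos m)
    obtain b where b: "int m ^ p = int m + int p * b" using nat by blast
    \<comment> \<open>Expanding \<open>0 ^ p\<close> links \<open>a ^ p\<close> to
      \<open>(- a) ^ p\<close> without using the parity of \<open>p\<close>, so \<open>p = 2\<close>
      is covered.\<close>
    obtain c where "(a + - a) ^ p = a ^ p + (- a) ^ p + int p * c"
      using power_prime_add[OF assms] by blast
    then have "a ^ p = a + int p * (- b - c)" using pos nonpos b by (simp add: zero_power algebra_simps)
    then show ?thesis by blast
  qed
qed

lemma int_poly_frobenius:
  fixes E :: "int poly" and x :: "'a :: comm_ring_1"
  assumes "prime p"
  shows "\<exists>H :: int poly. poly (of_int_poly E) x ^ p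
    = poly (of_int_poly E) (x ^ p) + of_nat p * poly (of_int_poly H) x"
proof (induction E)
  case 0
  show ?case using prime_gt_0_nat[OF assms] by (intro exI[of _ 0]) (simp add: zero_power)
next
  case (pCons a E)
  then obtain H :: "int poly" where H: "poly (of_int_poly E) x ^ p
    = poly (of_int_poly E) (x ^ p) + of_nat p * poly (of_int_poly H) x" by blast
  \<comment> \<open>The constant term is corrected by Fermat's little theorem. The power of the sum
    is expanded among integer polynomials, not at \<open>x\<close>, so that the error
    \<open>C\<close> is itself an integer polynomial.\<close>
  obtain b where b: "a ^ p = a + int p * b" using fermat_int[OF assms] by blast
  obtain C where C: "([:a:] + [:0, 1:] * E) ^ p = [:a:] ^ p + ([:0, 1:] * E) ^ p + of_nat p * C"
    using power_prime_add[OF assms] by blast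
  have "pCons a E = [:a:] + [:0, 1:] * E" by simp
  then have "poly (of_int_poly (pCons a E)) x ^ p = poly (of_int_poly (([:a:] + [:0, 1:] * E) ^ p)) x"
    by (simp only: hom_distribs poly_power)
  also have "\<dots> = of_int (a ^ p) + x ^ p * poly (of_int_poly E) x ^ p + of_nat p * poly (of_int_poly C) x"
    unfolding C by (simp add: hom_distribs power_mult_distrib)
  also have "\<dots> = poly (of_int_poly (pCons a E)) (x ^ p)
      + of_nat p * poly (of_int_poly ([:b:] + monom 1 p * H + C)) x"
    unfolding H b by (simp add: hom_distribs poly_monom algebra_simps)
  finally show ?case by blast
qed

lemma dvd_if_multiple_in_cyclotomic_integers:
  fixes x :: complex and m :: int and H :: "int poly"
  assumes "prime p" and "x ^ p = 1" and H: "of_int m = of_nat p * poly (of_int_poly H) x"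
  shows "int p dvd m"
  \<comment> \<open>Multiplication by \<open>H x\<close> acts on the powers of \<open>x\<close> by an integer circulant matrix \<open>A\<close>, so the
    integer matrix \<open>m I - p A\<close> is singular, while its determinant is \<open>m ^ p\<close> modulo \<open>p\<close>.\<close>
proof -
  have pos: "p > 0" using assms(1) prime_gt_0_nat by blast
  have x: "x ^ (k mod p) = x ^ k" for k
    using assms(2) by (metis mod_mult_div_eq mult.right_neutral power_add power_mult power_one)
  define d where "d = degree H"
  \<comment> \<open>Folding the exponents \<open>i + k\<close> modulo \<open>p\<close> lets row
    \<open>i\<close> express \<open>x ^ i * H x\<close> in the powers of \<open>x\<close> below
    \<open>p\<close>.\<close>
  define A where "A = (\<lambda>i j. \<Sum>k | k \<le> d \<and> (i + k) mod p = j. coeff H k)"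
  have A: "(\<Sum>j<p. of_int (A i j) * x ^ j) = x ^ i * poly (of_int_poly H) x" for i
  proof -
    have "(\<Sum>j<p. of_int (A i j) * x ^ j)
        = (\<Sum>j<p. \<Sum>k | k \<in> {..d} \<and> (i + k) mod p = j. of_int (coeff H k) * x ^ ((i + k) mod p))"
      by (simp add: A_def sum_distrib_right)
    also have "\<dots> = (\<Sum>k\<le>d. of_int (coeff H k) * x ^ ((i + k) mod p))"
      using pos by (intro sum.group) auto
    also have "\<dots> = x ^ i * poly (of_int_poly H) x"
      by (simp add: x poly_altdef d_def power_add sum_distrib_left mult.left_commute)
    finally show ?thesis .
  qed
  define D where "D = mat p p (\<lambda>(i, j). if i = j then m else 0)"
  define M where "M = mat p p (\<lambda>(i, j). (if i = j then m else 0) - int p * A i j)"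
  have "map_mat complex_of_int M *\<^sub>v vec p (\<lambda>j. x ^ j) = 0\<^sub>v p"
  proof (rule eq_vecI)
    fix i assume "i < dim_vec (0\<^sub>v p :: complex vec)"
    then have i: "i < p" by simp
    have "(map_mat complex_of_int M *\<^sub>v vec p (\<lambda>j. x ^ j)) $ i
        = (\<Sum>j<p. (if i = j then of_int m else 0) * x ^ j - of_nat p * (of_int (A i j) * x ^ j))"
      using i by (auto simp: M_def scalar_prod_def atLeast0LessThan algebra_simps intro!: sum.cong)
    also have "\<dots> = of_int m * x ^ i - of_nat p * (x ^ i * poly (of_int_poly H) x)"
      using i by (simp add: sum_subtractf A sum_distrib_left[symmetric] if_distrib[of "\<lambda>y. y * _"] cong: if_cong)
    finally show "(map_mat complex_of_int M *\<^sub>v vec p (\<lambda>j. x ^ j)) $ i = 0\<^sub>v p $ i"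
      using i H by simp
  qed (simp add: M_def)
  \<comment> \<open>Entry 0 of this kernel vector is 1.\<close>
  moreover have "vec p (\<lambda>j. x ^ j) \<noteq> 0\<^sub>v p"
    using pos by (metis index_vec index_zero_vec(1) power_0 zero_neq_one)
  ultimately have "det (map_mat complex_of_int M) = 0"
    by (subst det_0_iff_vec_prod_zero[of _ p]) (auto simp: M_def intro!: exI[of _ "vec p (\<lambda>j. x ^ j)"])
  then have "det M = 0" by simp
  moreover have "[det M = det D] (mod int p)"
  proof -
    have "M \<in> carrier_mat p p" "D \<in> carrier_mat p p" by (simp_all add: M_def D_def)
    moreover have "[M $$ (i, q i) = D $$ (i, q i)] (mod int p)"
      if "q permutes {0..<p}" "i < p" for q i
    proof -
      have "q i < p" using permutes_in_image[OF that(1), of i] that(2) by simp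
      then show ?thesis using that(2) by (simp add: M_def D_def cong_iff_dvd_diff)
    qed
    ultimately show ?thesis
      by (auto simp: det_def' intro!: cong_sum cong_mult cong_prod)
  qed
  moreover have "det D = m ^ p"
    by (subst det_upper_triangular[of _ p]) (auto simp: D_def prod_list_diag_prod)
  ultimately have "int p dvd m ^ p" by (simp add: cong_0_iff cong_sym_eq[of 0])
  then show ?thesis using assms(1) by (meson prime_dvd_power prime_nat_int_transfer)
qed

text \<open>Since \<open>x ^ p = 1\<close>, Frobenius turns \<open>E x = 0\<close> into
  \<open>0 = E 1 + p * H x\<close> with an integer polynomial \<open>H\<close>.\<close>

lemma dvd_poly_1_if_root_of_unity:
  fixes x :: complex and E :: "int poly"
  assumes "prime p" and "x ^ p = 1" and "poly (of_int_poly E) x = 0"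
  shows "int p dvd poly E 1"
proof -
  obtain H :: "int poly" where "poly (of_int_poly E) x ^ p
      = poly (of_int_poly E) (x ^ p) + of_nat p * poly (of_int_poly H) x"
    using int_poly_frobenius[OF assms(1)] by blast
  then have "of_int (- poly E 1) = of_nat p * poly (of_int_poly H) x"
    using assms prime_gt_0_nat[OF assms(1)] by (simp add: add_eq_0_iff2 zero_power)
  then have "int p dvd - poly E 1"
    by (rule dvd_if_multiple_in_cyclotomic_integers[OF assms(1,2)])
  then show ?thesis by simp
qed

section \<open>The binomial determinant modulo a prime\<close>

text \<open>After the factorials are absorbed into the rows and \<open>s j\<close> is pulled out of
  column \<open>j\<close>, the entries are monic polynomials \<open>P l\<close> of degree
  \<open>l\<close> at the squares of the \<open>s j\<close>, which gives a Vandermonde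
  determinant.\<close>

lemma fact_prod_times_det_binomial:
  "(\<Prod>l<k. int (fact (2 * l + 1))) * det (mat k k (\<lambda>(l, j). int ((s j + l) choose (2 * l + 1))))
    = (\<Prod>j<k. int (s j)) * (\<Prod>i<k. \<Prod>m<i. (int (s i))\<^sup>2 - (int (s m))\<^sup>2)"
proof -
  define P where "P l = (\<Prod>m<l. [:- ((int (Suc m))\<^sup>2), 1:])" for l
  have "(\<Prod>l<k. int (fact (2 * l + 1))) * det (mat k k (\<lambda>(l, j). int ((s j + l) choose (2 * l + 1))))
      = det (mat k k (\<lambda>(l, j). int (fact (2 * l + 1)) * 1 * int ((s j + l) choose (2 * l + 1))))"
    by (subst det_scale_rows_cols) simp
  also have "mat k k (\<lambda>(l, j). int (fact (2 * l + 1)) * 1 * int ((s j + l) choose (2 * l + 1)))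
      = transpose_mat (mat k k (\<lambda>(j, l). int (s j) * 1 * poly (P l) ((int (s j))\<^sup>2)))"
    unfolding mult_1_right fact_times_central_binomial
    by (rule eq_matI) (simp_all add: P_def poly_prod)
  also have "det \<dots> = (\<Prod>j<k. int (s j)) * det (mat k k (\<lambda>(j, l). poly (P l) ((int (s j))\<^sup>2)))"
    by (subst det_transpose[of _ k]) (simp, subst det_scale_rows_cols, simp)
  also have "det (mat k k (\<lambda>(j, l). poly (P l) ((int (s j))\<^sup>2)))
      = (\<Prod>i<k. \<Prod>m<i. (int (s i))\<^sup>2 - (int (s m))\<^sup>2)"
  proof (rule det_monic_alternant)
    show "lead_coeff (P l) = 1" for l by (simp add: P_def lead_coeff_prod)
    show "degree (P l) = l" for l
      unfolding P_def by (subst degree_prod_eq_sum_degree) auto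
  qed
  finally show ?thesis .
qed

lemma prime_not_dvd_det_binomial:
  assumes p: "prime p" and inj: "inj_on s {..<k}" and s: "\<And>j. j < k \<Longrightarrow> 0 < s j \<and> 2 * s j < p"
  shows "\<not> int p dvd det (mat k k (\<lambda>(l, j). int ((s j + l) choose (2 * l + 1))))"
proof
  have ip: "prime (int p)" using p by simp
  assume "int p dvd det (mat k k (\<lambda>(l, j). int ((s j + l) choose (2 * l + 1))))"
  then have "int p dvd (\<Prod>j<k. int (s j)) * (\<Prod>i<k. \<Prod>m<i. (int (s i))\<^sup>2 - (int (s m))\<^sup>2)"
    unfolding fact_prod_times_det_binomial[symmetric] by (rule dvd_mult)
  then consider j where "j < k" "int p dvd int (s j)"
    | i m where "i < k" "m < i" "int p dvd (int (s i))\<^sup>2 - (int (s m))\<^sup>2"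
    unfolding prime_dvd_mult_iff[OF ip] prime_dvd_prod_iff[OF finite_lessThan ip] by auto
  then show False
  proof cases
    case 1
    then show False using s[of j] by (auto dest: dvd_imp_le)
  next
    case 2
    have ne: "s i \<noteq> s m" using inj 2 by (auto dest: inj_onD)
    have sq: "(int (s i))\<^sup>2 - (int (s m))\<^sup>2 = (int (s i) - int (s m)) * (int (s i) + int (s m))"
      by (simp add: algebra_simps power2_eq_square)
    \<comment> \<open>Both factors are nonzero and below \<open>p\<close> in absolute value, because
      \<open>s i\<close> and \<open>s m\<close> are distinct, positive and less than
      \<open>p / 2\<close>.\<close>
    have "int p dvd int (s i) - int (s m) \<or> int p dvd int (s i) + int (s m)"
      using 2 unfolding sq by (simp add: prime_dvd_mult_iff[OF ip])
    then show False
      using s[of i] s[of m] 2 ne dvd_imp_le_int[of "int (s i) - int (s m)" "int p"]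
        dvd_imp_le_int[of "int (s i) + int (s m)" "int p"] by auto
  qed
qed

section \<open>Specialisation at a root of unity and at 1\<close>

lemma comm_ring_hom_poly_of_int_poly:
  "comm_ring_hom (\<lambda>q :: int poly. poly (of_int_poly q) (x :: 'a :: comm_ring_1))"
  by unfold_locales (simp_all add: hom_distribs)

lemma (in comm_ring_hom) hom_det_newton_coeff:
  "hom (det (mat k k (\<lambda>(l, j). newton_coeff w (f j) l)))
    = det (mat k k (\<lambda>(l, j). newton_coeff (\<lambda>i. hom (w i)) (map_poly hom (f j)) l))"
  unfolding hom_det[symmetric] newton_coeff_hom
  by (rule arg_cong[of _ _ det], rule eq_matI) simp_all

lemma det_sin_poly_nonzero:
  assumes p: "prime p" and "inj_on r {..<k}" and r: "\<And>i. i < k \<Longrightarrow> 0 < r i \<and> 2 * r i < p"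
    and s: "inj_on s {..<k}" "\<And>j. j < k \<Longrightarrow> 0 < s j \<and> 2 * s j < p"
  shows "det (mat k k (\<lambda>(i, j). poly (of_int_poly (sin_poly (s j))) (2 * cos (2 * pi * real (r i) / real p) - 2)))
    \<noteq> (0 :: real)"
proof
  define x where "x = cis (2 * pi / real p)"
  define c :: "nat \<Rightarrow> real" where "c i = 2 * cos (2 * pi * real (r i) / real p) - 2" for i
  \<comment> \<open>The exponent \<open>p - r i\<close> stands for \<open>- r i\<close>, keeping
    \<open>w i\<close> a polynomial; its value is \<open>c i\<close> at \<open>x\<close> and
    \<open>1 + 1 - 2 = 0\<close> at 1.\<close>
  define w :: "nat \<Rightarrow> int poly" where "w i = monom 1 (r i) + monom 1 (p - r i) - 2" for i
  \<comment> \<open>Coefficients become constant polynomials, so either evaluation gives back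
    \<open>sin_poly (s j)\<close> over the target ring.\<close>
  define f where "f j = map_poly (\<lambda>a. [:a:]) (sin_poly (s j))" for j
  define E where "E = det (mat k k (\<lambda>(l, j). newton_coeff w (f j) l))"
  interpret at_x: comm_ring_hom "\<lambda>q :: int poly. poly (of_int_poly q) x"
    by (rule comm_ring_hom_poly_of_int_poly)
  have at_1: "comm_ring_hom (\<lambda>q :: int poly. poly q 1)"
    by unfold_locales simp_all
  have pos: "p > 0" using p prime_gt_0_nat by blast
  have xp: "x ^ p = 1" using pos by (simp add: x_def DeMoivre)

  have wx: "poly (of_int_poly (w i)) x = complex_of_real (c i)" if "i < k" for i
  proof -
    have "x ^ r i * x ^ (p - r i) = 1"
      using r[OF that] xp by (simp flip: power_add)
    moreover have xr: "x ^ r i = cis (2 * pi * real (r i) / real p)"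
      by (simp add: x_def DeMoivre mult_ac)
    ultimately have "x ^ (p - r i) = cis (- (2 * pi * real (r i) / real p))"
      by (metis cis_inverse inverse_unique)
    with xr show ?thesis
      by (simp add: w_def c_def hom_distribs poly_monom complex_eq_iff)
  qed
  have fx: "map_poly (\<lambda>q :: int poly. poly (of_int_poly q) x) (f j)
      = of_int_poly (sin_poly (s j))" for j
    unfolding f_def by (subst map_poly_map_poly) (simp_all add: o_def hom_distribs)

  assume "det (mat k k (\<lambda>(i, j). poly (of_int_poly (sin_poly (s j)))
    (2 * cos (2 * pi * real (r i) / real p) - 2))) = (0 :: real)"
  then have "complex_of_real (det (mat k k (\<lambda>(i, j). poly (of_int_poly (sin_poly (s j))) (c i)))) = 0"
    by (simp add: c_def)
  also have "complex_of_real (det (mat k k (\<lambda>(i, j). poly (of_int_poly (sin_poly (s j))) (c i))))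
     = det (mat k k (\<lambda>(i, j). poly (map_poly (\<lambda>q :: int poly. poly (of_int_poly q) x) (f j)) (poly (of_int_poly (w i)) x)))"
    unfolding of_real_hom.hom_det[symmetric] fx
  proof (rule arg_cong[of _ _ det], rule eq_matI)
    fix i j assume ij: "i < dim_row (mat k k (\<lambda>(i, j). poly (of_int_poly (sin_poly (s j))) (poly (of_int_poly (w i)) x)))"
      "j < dim_col (mat k k (\<lambda>(i, j). poly (of_int_poly (sin_poly (s j))) (poly (of_int_poly (w i)) x)))"
    have "of_int_poly (sin_poly (s j)) = map_poly complex_of_real (of_int_poly (sin_poly (s j)))"
      by (subst map_poly_map_poly) (simp_all add: o_def)
    then show "map_mat complex_of_real (mat k k (\<lambda>(i, j). poly (of_int_poly (sin_poly (s j))) (c i))) $$ (i, j)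
        = mat k k (\<lambda>(i, j). poly (of_int_poly (sin_poly (s j))) (poly (of_int_poly (w i)) x)) $$ (i, j)"
      using ij by (simp add: wx)
  qed simp_all
  also have "\<dots> = (\<Prod>i<k. \<Prod>m<i. poly (of_int_poly (w i)) x - poly (of_int_poly (w m)) x)
      * poly (of_int_poly E) x"
    unfolding E_def at_x.hom_det_newton_coeff by (rule det_alternant)
  finally have "(\<Prod>i<k. \<Prod>m<i. poly (of_int_poly (w i)) x - poly (of_int_poly (w m)) x) = 0
      \<or> poly (of_int_poly E) x = 0"
    by simp
  \<comment> \<open>The angles lie in \<open>[0, pi]\<close>, where cosine is injective.\<close>
  moreover have "poly (of_int_poly (w i)) x \<noteq> poly (of_int_poly (w m)) x" if "i < k" "m < i" for i m
  proof
    assume "poly (of_int_poly (w i)) x = poly (of_int_poly (w m)) x"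
    then have eq: "cos (2 * pi * real (r i) / real p) = cos (2 * pi * real (r m) / real p)"
      using that by (simp add: wx c_def)
    have bounds: "0 \<le> 2 * pi * real (r j) / real p" "2 * pi * real (r j) / real p \<le> pi"
      if "j < k" for j
      using r[OF that] pos by (auto simp: field_simps)
    have "2 * pi * real (r i) / real p = 2 * pi * real (r m) / real p"
      using that by (intro cos_inj_pi[OF _ _ _ _ eq] bounds) linarith+
    then have "r i = r m" using pos by (simp add: field_simps)
    then show False using assms(2) that by (auto dest: inj_onD)
  qed
  ultimately have "poly (of_int_poly E) x = 0" by auto
  then have "int p dvd poly E 1" by (rule dvd_poly_1_if_root_of_unity[OF p xp])
  \<comment> \<open>All nodes are now 0, so the Newton coefficients become ordinary coefficients,
    that is, binomials.\<close>
  also have "poly E 1 = det (mat k k (\<lambda>(l, j). newton_coeff (\<lambda>_. 0) (sin_poly (s j)) l))"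
  proof -
    have "poly (w i) 1 = 0" for i by (simp add: w_def poly_monom)
    moreover have "map_poly (\<lambda>q :: int poly. poly q 1) (f j) = sin_poly (s j)" for j
      unfolding f_def by (subst map_poly_map_poly) (simp_all add: o_def)
    ultimately show ?thesis unfolding E_def comm_ring_hom.hom_det_newton_coeff[OF at_1] by simp
  qed
  finally show False
    using prime_not_dvd_det_binomial[OF p s] by (simp add: newton_coeff_zero_points coeff_sin_poly)
qed

section \<open>Minors of the sine matrix\<close>

lemma inj_on_pick: "inj_on (pick I) {..<card I}"
  by (rule inj_onI) (metis card_pick_le lessThan_iff)

theorem theorem1p3:
  fixes n :: nat
  assumes "n \<ge> 3" and "odd n"
  shows "nonvanishing_minors (dst_mat n) \<longleftrightarrow> prime n"
proof
  let ?h = "(n - 1) div 2"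
  assume nv: "nonvanishing_minors (dst_mat n)"
  show "prime n"
  proof (rule ccontr)
    assume "\<not> prime n"
    then obtain a where "a dvd n" "a \<noteq> 1" "a \<noteq> n"
      using assms(1) by (auto simp: prime_nat_iff)
    then obtain b where ab: "n = a * b" "a \<noteq> 1" "a \<noteq> n" by (elim dvdE) simp
    \<comment> \<open>Oddness forces both factors to be at least 3, hence at most
      \<open>n / 3\<close>, so row \<open>a\<close> and column \<open>b\<close> exist.\<close>
    have "odd a" "odd b" using assms(2) ab(1) by simp_all
    then have "a \<noteq> 0" "a \<noteq> 2" "b \<noteq> 0" "b \<noteq> 2" by (auto intro: odd_pos)
    moreover have "b \<noteq> 1" using ab by auto
    ultimately have ab3: "a \<ge> 3" "b \<ge> 3" using ab(2) by linarith+
    have "3 * b \<le> n" "3 * a \<le> n"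
      using mult_le_mono1[OF ab3(1), of b] mult_le_mono1[OF ab3(2), of a] ab(1)
      by (simp_all add: mult.commute)
    then have lt: "a - 1 < ?h" "b - 1 < ?h" using ab3 by linarith+
    define M where "M = submatrix (dst_mat n) {a - 1} {b - 1}"
    have card: "{i. i < ?h \<and> i \<in> {a - 1}} = {a - 1}" "{i. i < ?h \<and> i \<in> {b - 1}} = {b - 1}"
      using lt by auto
    \<comment> \<open>This is the form \<open>pick\<close> takes on a singleton at index 0.\<close>
    have least: "(LEAST a. a = x) = x" for x :: nat by (rule Least_equality) simp_all
    have dim: "dim_row (dst_mat n) = ?h" "dim_col (dst_mat n) = ?h" by (simp_all add: dst_mat_def)
    have M: "M = mat 1 1 (\<lambda>_. dst_mat n $$ (a - 1, b - 1))"
      unfolding M_def submatrix_def dim card by (intro eq_matI) (simp_all add: least)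
    have "2 * pi * real (a - 1 + 1) * real (b - 1 + 1) / real n = 2 * pi"
      using ab3 ab(1) by simp
    then have "dst_mat n $$ (a - 1, b - 1) = 0"
      unfolding dst_mat_def using lt by simp
    then have "det M = 0" by (simp add: M det_single)
    moreover have "det M \<noteq> 0"
      using nv lt unfolding nonvanishing_minors_def M_def dim by simp
    ultimately show False by simp
  qed
next
  let ?h = "(n - 1) div 2"
  assume p: "prime n"
  show "nonvanishing_minors (dst_mat n)"
    unfolding nonvanishing_minors_def
  proof (intro conjI allI impI)
    show "square_mat (dst_mat n)" by (simp add: dst_mat_def)
    fix I J
    assume I: "I \<subseteq> {0..<dim_row (dst_mat n)}" and J: "J \<subseteq> {0..<dim_col (dst_mat n)}"
      and IJ: "card I = card J"
    define k where "k = card I"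
    \<comment> \<open>\<open>Suc\<close> restores the 1-based frequencies; an index below
      \<open>(n - 1) div 2\<close> then gives \<open>0 < r i\<close> and
      \<open>2 * r i < n\<close>.\<close>
    define r where "r i = Suc (pick I i)" for i
    define s where "s j = Suc (pick J j)" for j
    have dim: "dim_row (dst_mat n) = ?h" "dim_col (dst_mat n) = ?h" by (simp_all add: dst_mat_def)
    have IJh: "I \<subseteq> {0..<?h}" "J \<subseteq> {0..<?h}" using I J unfolding dim by simp_all
    have "{i. i < ?h \<and> i \<in> I} = I" "{j. j < ?h \<and> j \<in> J} = J"
      using IJh by auto
    then have card: "card {i. i < ?h \<and> i \<in> I} = k" "card {j. j < ?h \<and> j \<in> J} = k"
      using IJ by (simp_all only: k_def)
    have sub: "submatrix (dst_mat n) I J = mat k k (\<lambda>(i, j). dst_mat n $$ (pick I i, pick J j))"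
      unfolding submatrix_def dim card ..
    have pickI: "pick I i < ?h" if "i < k" for i
      using pick_in_set_le[of i I] that IJh by (auto simp: k_def)
    have pickJ: "pick J j < ?h" if "j < k" for j
      using pick_in_set_le[of j J] that IJh IJ by (auto simp: k_def)
    have r: "0 < r i \<and> 2 * r i < n" if "i < k" for i
      using pickI[OF that] by (auto simp: r_def)
    have s: "0 < s j \<and> 2 * s j < n" if "j < k" for j
      using pickJ[OF that] by (auto simp: s_def)
    have inj: "inj_on r {..<k}" "inj_on s {..<k}"
      using inj_on_pick[of I] inj_on_pick[of J] IJ
      by (auto simp: inj_on_def r_def s_def k_def)
    define t where "t i = 2 * pi * real (r i) / real n" for i
    have sin: "sin (t i) \<noteq> 0" if "i < k" for i
    proof -
      have "0 < t i" "t i < pi" using r[OF that] by (auto simp: t_def field_simps)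
      then show ?thesis using sin_gt_zero by force
    qed
    \<comment> \<open>\<open>sin_multiple\<close> leaves a factor depending on the row only; the
      \<open>1\<close> is the trivial column factor for \<open>det_scale_rows_cols\<close>.\<close>
    have "submatrix (dst_mat n) I J = mat k k (\<lambda>(i, j). 2 * sin (t i) / sqrt (real n) * 1
        * poly (of_int_poly (sin_poly (s j))) (2 * cos (2 * pi * real (r i) / real n) - 2))"
      (is "_ = ?R")
    proof (rule eq_matI)
      fix i j assume "i < dim_row ?R" "j < dim_col ?R"
      then have ij: "i < k" "j < k" by simp_all
      have "submatrix (dst_mat n) I J $$ (i, j) = 2 * sin (real (s j) * t i) / sqrt (real n)"
        unfolding sub using ij pickI[OF ij(1)] pickJ[OF ij(2)]
        by (simp add: dst_mat_def r_def s_def t_def mult_ac)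
      also have "\<dots> = ?R $$ (i, j)"
        using ij unfolding sin_multiple by (simp add: t_def)
      finally show "submatrix (dst_mat n) I J $$ (i, j) = ?R $$ (i, j)" .
    qed (simp_all add: sub)
    then have "det (submatrix (dst_mat n) I J) = (\<Prod>i<k. 2 * sin (t i) / sqrt (real n))
        * det (mat k k (\<lambda>(i, j). poly (of_int_poly (sin_poly (s j))) (2 * cos (2 * pi * real (r i) / real n) - 2)))"
      by (simp only:) (subst det_scale_rows_cols, simp)
    moreover have "\<dots> \<noteq> 0"
      using det_sin_poly_nonzero[OF p inj(1) r inj(2) s] sin assms(1) by simp
    ultimately show "det (submatrix (dst_mat n) I J) \<noteq> 0" by (simp only: not_False_eq_True)
  qed
qed

end
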